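(* Let $S$ be a finite semigroup generated by $X$, and let $T$ be a proper subset of $S$ such that $S\setminus T$ is contained in a regular $\mathcal{J}$-class $J$ of $S$. Suppose that there exist proper subsets $A\subsetneq J/\mathcal{L}$ and $B\subsetneq J/\mathcal{R}$ such that $T\cap J$ is the union of the Green's classes in $A$ and in $B$. Then $T$ is a subsemigroup of $S$ if and only if the following hold: (i) $A$ is a union of vertices of $\Gamma_{\mathcal{L}}$, and $B$ is a union of vertices of $\Gamma_{\mathcal{R}}$; (ii) if $U$ and $V$ are vertices of $\Gamma_{\mathcal{L}}$ such that $U$ is contained in $A$ and there is an edge from $U$ to $V$ in $\Gamma_{\mathcal{L}}$, then $V$ is contained in $A$; (iii) if $U$ and $V$ are vertices of $\Gamma_{\mathcal{R}}$ such that $U$ is contained in $B$ and there is an edge from $U$ to $V$ in $\Gamma_{\mathcal{R}}$, then $V$ is contained in $B$; (iv) if $\{U,V\}$ is an edge in $\Theta$, then either $U$ or $V$, or both, is contained in $A\cup B$; (v) the vertices contained in $A\cup B$ form an independent set of $\Delta$.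
   Context: A subsemigroup is a subset closed under the operation. $\mathcal{L},\mathcal{R},\mathcal{H},\mathcal{J}$ are Green's relations on $S$; $J/\mathcal{L}$ and $J/\mathcal{R}$ are the sets of $\mathcal{L}$- and $\mathcal{R}$-classes of $S$ contained in $J$. A $\mathcal{J}$-class is regular if it contains an idempotent. $\mathcal{J}$-classes are partially ordered by containment of the principal two-sided ideals generated by their elements; $J_x$ is the $\mathcal{J}$-class of $x$. $\langle Y\rangle$ is the least subsemigroup containing $Y$. Let $X'=\{x\in X: J_x>J\}$. $\Gamma_{\mathcal{L}}$ is the quotient, by its strongly connected components, of the digraph with vertex set $J/\mathcal{L}$ and an edge $(L_a,L_b)$ whenever $L_a\neq L_b$ and $L_ax=L_b$ for some $x\in X'$. Thus a vertex of $\Gamma_{\mathcal{L}}$ is a strongly connected component (a set of $\mathcal{L}$-classes of $J$), and there is an edge from a vertex $U$ to a different vertex $V$ if there is an edge of the original digraph from some element of $U$ to some element of $V$. $\Gamma_{\mathcal{R}}$ is defined dually, from the digraph on $J/\mathcal{R}$ with edges $(R_a,R_b)$ where $R_a\ne R_b$ and $xR_a=R_b$ for some $x\in X'$. $\Delta$ is the (bipartite) graph whose vertex set is the disjoint union of the vertices of $\Gamma_{\mathcal{L}}$ and of $\Gamma_{\mathcal{R}}$, with an edge $\{U,V\}$ ($U$ a vertex of $\Gamma_{\mathcal{L}}$, $V$ a vertex of $\Gamma_{\mathcal{R}}$) if the intersection of some $\mathcal{L}$-class in $U$ with some $\mathcal{R}$-class in $V$ is a group $\mathcal{H}$-class. $\Theta$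 is the graph with the same vertex set, with an edge $\{U,V\}$ ($U$ from $\Gamma_{\mathcal{L}}$, $V$ from $\Gamma_{\mathcal{R}}$) if there is an element of $\langle X'\rangle$ in the intersection of some $\mathcal{L}$-class in $U$ with some $\mathcal{R}$-class in $V$. *)

theory Defs
  imports
    "HOL.Hull"
    "HOL-Algebra.Group"
    "Graph_Theory.Digraph_Component"
    "Graph_Theory.Pair_Digraph"
begin

text \<open>The semigroup \<open>S\<close> is the whole of a type of class \<open>semigroup_mult\<close>.\<close>

section \<open>Subsemigroups and Green's relations\<close>

text \<open>The empty set counts as a subsemigroup, so the subsemigroup generated by \<open>{}\<close> is \<open>{}\<close>.\<close>

definition subsemigroup :: "'a::semigroup_mult set \<Rightarrow> bool" where
  "subsemigroup T \<longleftrightarrow> (\<forall>x\<in>T. \<forall>y\<in>T. x * y \<in> T)"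

definition generated_subsemigroup :: "'a::semigroup_mult set \<Rightarrow> 'a set" where
  "generated_subsemigroup Y = subsemigroup hull Y"

text \<open>
  The principal ideals \<open>S\<^sup>1a\<close>, \<open>aS\<^sup>1\<close> and \<open>S\<^sup>1aS\<^sup>1\<close>, where \<open>S\<^sup>1\<close> is \<open>S\<close> with an identity adjoined;
  \<open>S\<close> itself need not be a monoid.
\<close>

definition left_ideal :: "'a::semigroup_mult \<Rightarrow> 'a set" where
  "left_ideal a = {a} \<union> {s * a |s. True}"

definition right_ideal :: "'a::semigroup_mult \<Rightarrow> 'a set" where
  "right_ideal a = {a} \<union> {a * s |s. True}"

definition two_sided_ideal :: "'a::semigroup_mult \<Rightarrow> 'a set" where
  "two_sided_ideal a =
     {a} \<union> {s * a |s. True} \<union> {a * t |t. True} \<union> {s * a * t |s t. True}"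

definition green_L :: "'a::semigroup_mult rel" where
  "green_L = {(a, b). left_ideal a = left_ideal b}"

definition green_R :: "'a::semigroup_mult rel" where
  "green_R = {(a, b). right_ideal a = right_ideal b}"

definition green_H :: "'a::semigroup_mult rel" where
  "green_H = green_L \<inter> green_R"

definition green_J :: "'a::semigroup_mult rel" where
  "green_J = {(a, b). two_sided_ideal a = two_sided_ideal b}"

definition L_classes_in :: "'a::semigroup_mult set \<Rightarrow> 'a set set" where
  "L_classes_in J = {K \<in> UNIV // green_L. K \<subseteq> J}"

definition R_classes_in :: "'a::semigroup_mult set \<Rightarrow> 'a set set" where
  "R_classes_in J = {K \<in> UNIV // green_R. K \<subseteq> J}"

definition regular_J_class :: "'a::semigroup_mult set \<Rightarrow> bool" where
  "regular_J_class J \<longleftrightarrow> J \<in> UNIV // green_J \<and> (\<exists>e\<in>J. e * e = e)"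

definition J_class_le :: "'a::semigroup_mult set \<Rightarrow> 'a set \<Rightarrow> bool" where
  "J_class_le C D \<longleftrightarrow> (\<forall>a\<in>C. \<forall>b\<in>D. two_sided_ideal a \<subseteq> two_sided_ideal b)"

definition J_class_less :: "'a::semigroup_mult set \<Rightarrow> 'a set \<Rightarrow> bool" where
  "J_class_less C D \<longleftrightarrow> J_class_le C D \<and> C \<noteq> D"

definition group_H_class :: "'a::semigroup_mult set \<Rightarrow> bool" where
  "group_H_class H \<longleftrightarrow> H \<in> UNIV // green_H \<and>
     (\<exists>e. Group.group \<lparr>carrier = H, monoid.mult = (*), one = e\<rparr>)"

text \<open>The set \<open>X'\<close> of those \<open>x \<in> X\<close> with \<open>J\<^sub>x > J\<close>.\<close>

definition gens_above :: "'a::semigroup_mult set \<Rightarrow> 'a set \<Rightarrow> 'a set" where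
  "gens_above X J = {x \<in> X. J_class_less J (green_J `` {x})}"

section \<open>The digraphs \<open>\<Gamma>\<^sub>L\<close> and \<open>\<Gamma>\<^sub>R\<close>\<close>

definition scc_quotient :: "'v pair_pre_digraph \<Rightarrow> 'v set pair_pre_digraph" where
  "scc_quotient G =
     (let W = pre_digraph.sccs_verts (with_proj G) in
      \<lparr>pverts = W,
       parcs = {(U, V). U \<in> W \<and> V \<in> W \<and> U \<noteq> V \<and> (\<exists>a\<in>U. \<exists>b\<in>V. (a, b) \<in> parcs G)}\<rparr>)"

definition L_digraph :: "'a::semigroup_mult set \<Rightarrow> 'a set \<Rightarrow> 'a set pair_pre_digraph" where
  "L_digraph X J =
     \<lparr>pverts = L_classes_in J,
      parcs = {(K, M). K \<in> L_classes_in J \<and> M \<in> L_classes_in J \<and> K \<noteq> M \<and>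
                 (\<exists>x\<in>gens_above X J. (\<lambda>k. k * x) ` K = M)}\<rparr>"

definition R_digraph :: "'a::semigroup_mult set \<Rightarrow> 'a set \<Rightarrow> 'a set pair_pre_digraph" where
  "R_digraph X J =
     \<lparr>pverts = R_classes_in J,
      parcs = {(K, M). K \<in> R_classes_in J \<and> M \<in> R_classes_in J \<and> K \<noteq> M \<and>
                 (\<exists>x\<in>gens_above X J. (\<lambda>k. x * k) ` K = M)}\<rparr>"

definition Gamma_L :: "'a::semigroup_mult set \<Rightarrow> 'a set \<Rightarrow> 'a set set pair_pre_digraph" where
  "Gamma_L X J = scc_quotient (L_digraph X J)"

definition Gamma_R :: "'a::semigroup_mult set \<Rightarrow> 'a set \<Rightarrow> 'a set set pair_pre_digraph" where
  "Gamma_R X J = scc_quotient (R_digraph X J)"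

section \<open>The graphs \<open>\<Delta>\<close> and \<open>\<Theta>\<close>\<close>

text \<open>
  An undirected graph is a pair of a vertex set and a set of two-element sets of vertices.
  The vertices of \<open>\<Gamma>\<^sub>L\<close> are tagged \<open>Inl\<close> and those of \<open>\<Gamma>\<^sub>R\<close> are tagged \<open>Inr\<close>, because an L-class
  and an R-class may coincide as sets.
\<close>

type_synonym 'v ugraph = "'v set \<times> 'v set set"

definition independent_in :: "'v ugraph \<Rightarrow> 'v set \<Rightarrow> bool" where
  "independent_in G I \<longleftrightarrow> I \<subseteq> fst G \<and> (\<forall>u\<in>I. \<forall>v\<in>I. {u, v} \<notin> snd G)"

type_synonym 'a bivertex = "'a set set + 'a set set"

definition bivertices :: "'a::semigroup_mult set \<Rightarrow> 'a set \<Rightarrow> 'a bivertex set" where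
  "bivertices X J = pverts (Gamma_L X J) <+> pverts (Gamma_R X J)"

definition Delta :: "'a::semigroup_mult set \<Rightarrow> 'a set \<Rightarrow> 'a bivertex ugraph" where
  "Delta X J =
     (bivertices X J,
      {{Inl U, Inr V} |U V. U \<in> pverts (Gamma_L X J) \<and> V \<in> pverts (Gamma_R X J) \<and>
         (\<exists>K\<in>U. \<exists>M\<in>V. group_H_class (K \<inter> M))})"

definition Theta :: "'a::semigroup_mult set \<Rightarrow> 'a set \<Rightarrow> 'a bivertex ugraph" where
  "Theta X J =
     (bivertices X J,
      {{Inl U, Inr V} |U V. U \<in> pverts (Gamma_L X J) \<and> V \<in> pverts (Gamma_R X J) \<and>
         (\<exists>K\<in>U. \<exists>M\<in>V. generated_subsemigroup (gens_above X J) \<inter> (K \<inter> M) \<noteq> {})})"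

text \<open>
  Containment of a vertex in \<open>A \<union> B\<close>, the union being that of a set \<open>A\<close> of L-classes and a set \<open>B\<close>
  of R-classes, regarded as disjoint like the two kinds of vertices.
\<close>

definition bivertex_in :: "'a set set \<Rightarrow> 'a set set \<Rightarrow> 'a bivertex \<Rightarrow> bool" where
  "bivertex_in A B v = (case v of Inl U \<Rightarrow> U \<subseteq> A | Inr V \<Rightarrow> V \<subseteq> B)"

end

theory Submission
  imports Defs
begin

text \<open>
  By stability, if \<open>a\<close> and \<open>ab\<close> both lie in \<open>J\<close> then they are R-related, and dually. Since every
  L-class of \<open>J\<close> meets every R-class of \<open>J\<close>, and some L-class and some R-class avoid \<open>A\<close> and \<open>B\<close>,
  a factor of a product can be moved inside its L-class or R-class so that the product leaves \<open>T\<close>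
  whenever one of the conditions fails. Conversely, let \<open>ab \<in> J\<close> with \<open>a, b \<in> T\<close>. A factor outside
  \<open>J\<close> is a product of elements of \<open>X'\<close>, so if one factor is in \<open>J\<close> then multiplying by the other
  walks along the digraph; if neither is, then \<open>ab \<in> \<langle>X'\<rangle>\<close>; and if both are, then \<open>L\<^sub>a \<inter> R\<^sub>b\<close>
  contains an idempotent (Clifford and Miller).
\<close>

section \<open>Principal ideals in a finite semigroup\<close>

lemma left_ideal_iff: "b \<in> left_ideal a \<longleftrightarrow> b = a \<or> (\<exists>s. b = s * a)"
  by (auto simp: left_ideal_def)

lemma right_ideal_iff: "b \<in> right_ideal a \<longleftrightarrow> b = a \<or> (\<exists>s. b = a * s)"
  by (auto simp: right_ideal_def)

lemma left_ideal_subset_iff: "left_ideal b \<subseteq> left_ideal a \<longleftrightarrow> b \<in> left_ideal a"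
  unfolding subset_iff left_ideal_iff by (metis mult.assoc)

lemma right_ideal_subset_iff: "right_ideal b \<subseteq> right_ideal a \<longleftrightarrow> b \<in> right_ideal a"
  unfolding subset_iff right_ideal_iff by (metis mult.assoc)

lemma left_ideal_eq_iff: "left_ideal a = left_ideal b \<longleftrightarrow> a \<in> left_ideal b \<and> b \<in> left_ideal a"
  using left_ideal_subset_iff by blast

lemma right_ideal_eq_iff: "right_ideal a = right_ideal b \<longleftrightarrow> a \<in> right_ideal b \<and> b \<in> right_ideal a"
  using right_ideal_subset_iff by blast

text \<open>Together with \<open>two_sided_ideal_right_left\<close> this passes from a to b through
  an intermediate element, with free choice of the side multiplied first. Stability then applies to
  each one-sided step.\<close>

lemma two_sided_ideal_left_right:
  "b \<in> two_sided_ideal a \<longleftrightarrow> (\<exists>c\<in>left_ideal a. b \<in> right_ideal c)"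
  unfolding two_sided_ideal_def left_ideal_def right_ideal_def by auto

lemma two_sided_ideal_right_left:
  "b \<in> two_sided_ideal a \<longleftrightarrow> (\<exists>c\<in>right_ideal a. b \<in> left_ideal c)"
  unfolding two_sided_ideal_def left_ideal_def right_ideal_def
  by (auto simp: mult.assoc)

lemma two_sided_ideal_subset_iff:
  "two_sided_ideal b \<subseteq> two_sided_ideal a \<longleftrightarrow> b \<in> two_sided_ideal a"
proof
  show "b \<in> two_sided_ideal a" if "two_sided_ideal b \<subseteq> two_sided_ideal a"
    using that by (auto simp: two_sided_ideal_def)
  assume "b \<in> two_sided_ideal a"
  then obtain c where c: "c \<in> left_ideal a" "b \<in> right_ideal c"
    by (auto simp: two_sided_ideal_left_right)
  show "two_sided_ideal b \<subseteq> two_sided_ideal a"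
  proof
    fix x assume "x \<in> two_sided_ideal b"
    then obtain d where d: "d \<in> right_ideal b" "x \<in> left_ideal d"
      by (auto simp: two_sided_ideal_right_left)
    have "d \<in> right_ideal c"
      using c d right_ideal_subset_iff by blast
    then have "x \<in> two_sided_ideal c"
      using d two_sided_ideal_right_left by blast
    then obtain y where y: "y \<in> left_ideal c" "x \<in> right_ideal y"
      by (auto simp: two_sided_ideal_left_right)
    then show "x \<in> two_sided_ideal a"
      using c left_ideal_subset_iff two_sided_ideal_left_right by blast
  qed
qed

lemma two_sided_ideal_eq_iff:
  "two_sided_ideal a = two_sided_ideal b \<longleftrightarrow> a \<in> two_sided_ideal b \<and> b \<in> two_sided_ideal a"
  using two_sided_ideal_subset_iff by blast

lemma mult_in_ideals:
  "a * b \<in> left_ideal b" "a * b \<in> right_ideal a"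
  "a * b \<in> two_sided_ideal a" "a * b \<in> two_sided_ideal b"
  by (auto simp: left_ideal_def right_ideal_def two_sided_ideal_def)

lemma left_ideal_subset_two_sided: "left_ideal a \<subseteq> two_sided_ideal a"
  by (auto simp: left_ideal_def two_sided_ideal_def)

lemma right_ideal_subset_two_sided: "right_ideal a \<subseteq> two_sided_ideal a"
  by (auto simp: right_ideal_def two_sided_ideal_def)

lemma left_ideal_mult_right: "b \<in> left_ideal a \<Longrightarrow> b * c \<in> left_ideal (a * c)"
  by (auto simp: left_ideal_iff mult.assoc)

lemma right_ideal_mult_left: "b \<in> right_ideal a \<Longrightarrow> c * b \<in> right_ideal (c * a)"
  by (auto simp: right_ideal_iff mult.assoc)

text \<open>
  If \<open>a \<in> S\<^sup>1y\<close> with \<open>y \<in> bS\<^sup>1\<close>, then left multiplication maps \<open>yS\<^sup>1 \<subseteq> bS\<^sup>1\<close> onto \<open>aS\<^sup>1\<close>,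
  so counting turns \<open>bS\<^sup>1 \<subseteq> aS\<^sup>1\<close> into an equality.
\<close>

lemma stable_R:
  fixes a b :: "'a::{semigroup_mult, finite}"
  assumes b: "b \<in> right_ideal a" and a: "a \<in> two_sided_ideal b"
  shows "right_ideal b = right_ideal a"
proof (rule card_seteq)
  show "right_ideal b \<subseteq> right_ideal a"
    using b by (simp add: right_ideal_subset_iff)
  obtain y where y: "y \<in> right_ideal b" "a \<in> left_ideal y"
    using a by (auto simp: two_sided_ideal_right_left)
  have "right_ideal (s * y) = (\<lambda>z. s * z) ` right_ideal y" for s
    unfolding right_ideal_def by (auto simp: mult.assoc image_iff)
  then have "card (right_ideal a) \<le> card (right_ideal y)"
    using y(2) by (metis left_ideal_iff card_image_le finite order_refl)
  also have "\<dots> \<le> card (right_ideal b)"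
    using y(1) by (intro card_mono) (simp_all add: right_ideal_subset_iff)
  finally show "card (right_ideal a) \<le> card (right_ideal b)" .
qed simp

lemma stable_L:
  fixes a b :: "'a::{semigroup_mult, finite}"
  assumes b: "b \<in> left_ideal a" and a: "a \<in> two_sided_ideal b"
  shows "left_ideal b = left_ideal a"
proof (rule card_seteq)
  show "left_ideal b \<subseteq> left_ideal a"
    using b by (simp add: left_ideal_subset_iff)
  obtain y where y: "y \<in> left_ideal b" "a \<in> right_ideal y"
    using a by (auto simp: two_sided_ideal_left_right)
  have "left_ideal (y * s) = (\<lambda>z. z * s) ` left_ideal y" for s
    unfolding left_ideal_def by (auto simp: mult.assoc image_iff) (metis mult.assoc)
  then have "card (left_ideal a) \<le> card (left_ideal y)"
    using y(2) by (metis right_ideal_iff card_image_le finite order_refl)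
  also have "\<dots> \<le> card (left_ideal b)"
    using y(1) by (intro card_mono) (simp_all add: left_ideal_subset_iff)
  finally show "card (left_ideal a) \<le> card (left_ideal b)" .
qed simp

lemma left_ideal_eq_imp_two_sided: "left_ideal a = left_ideal b \<Longrightarrow> two_sided_ideal a = two_sided_ideal b"
  using left_ideal_subset_two_sided unfolding left_ideal_eq_iff two_sided_ideal_eq_iff by blast

lemma right_ideal_eq_imp_two_sided: "right_ideal a = right_ideal b \<Longrightarrow> two_sided_ideal a = two_sided_ideal b"
  using right_ideal_subset_two_sided unfolding right_ideal_eq_iff two_sided_ideal_eq_iff by blast

text \<open>The inclusion of J in D for finite semigroups: an element \<open>y\<close> of bS^1 with
  a in S^1y is J-equivalent to both a and b, so by stability it is R-related to b and L-related to
  a.\<close>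

lemma L_meets_R:
  fixes a b :: "'a::{semigroup_mult, finite}"
  assumes "two_sided_ideal a = two_sided_ideal b"
  obtains c where "left_ideal c = left_ideal a" "right_ideal c = right_ideal b"
proof -
  obtain y where y: "y \<in> right_ideal b" "a \<in> left_ideal y"
    using assms by (auto simp: two_sided_ideal_right_left two_sided_ideal_eq_iff)
  have "y \<in> two_sided_ideal b" "a \<in> two_sided_ideal y"
    using y left_ideal_subset_two_sided right_ideal_subset_two_sided by auto
  then have "b \<in> two_sided_ideal y" "y \<in> two_sided_ideal a"
    using assms two_sided_ideal_subset_iff by blast+
  then show thesis
    using y stable_L stable_R that by metis
qed

section \<open>Classes as sets, and Green's lemma on translations\<close>

definition L_class :: "'a::semigroup_mult \<Rightarrow> 'a set" where
  "L_class a = green_L `` {a}"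

definition R_class :: "'a::semigroup_mult \<Rightarrow> 'a set" where
  "R_class a = green_R `` {a}"

lemma L_class_iff: "b \<in> L_class a \<longleftrightarrow> left_ideal a = left_ideal b"
  by (simp add: L_class_def green_L_def)

lemma R_class_iff: "b \<in> R_class a \<longleftrightarrow> right_ideal a = right_ideal b"
  by (simp add: R_class_def green_R_def)

lemma L_class_eq_iff: "L_class a = L_class b \<longleftrightarrow> left_ideal a = left_ideal b"
  by (auto simp: set_eq_iff L_class_iff)

lemma R_class_eq_iff: "R_class a = R_class b \<longleftrightarrow> right_ideal a = right_ideal b"
  by (auto simp: set_eq_iff R_class_iff)

text \<open>Green's lemma. By stability a lies in axS^1, and a multiplier \<open>s\<close> with axs
  = a carries the L-class of ax back into that of a.\<close>

lemma L_translate: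
  fixes a x :: "'a::{semigroup_mult, finite}"
  assumes "two_sided_ideal (a * x) = two_sided_ideal a"
  shows "(\<lambda>k. k * x) ` L_class a = L_class (a * x)"
proof -
  have "a \<in> right_ideal (a * x)"
    using assms stable_R[OF mult_in_ideals(2)[of a x]]
    by (simp add: two_sided_ideal_eq_iff right_ideal_eq_iff)
  show ?thesis
  proof (intro equalityI subsetI)
    fix m assume "m \<in> L_class (a * x)"
    then have m: "left_ideal (a * x) = left_ideal m"
      by (simp add: L_class_iff)
    show "m \<in> (\<lambda>k. k * x) ` L_class a"
    proof (cases "a = a * x")
      \<comment> \<open>Here membership in \<open>right_ideal (a * x)\<close> supplies no
        multiplier, but \<open>x\<close> fixes \<open>a\<close>, hence every left multiple of
        \<open>a\<close>, in particular \<open>m\<close>.\<close>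
      case True
      then have "m * x = m"
        using m by (metis left_ideal_eq_iff left_ideal_iff mult.assoc)
      moreover have "m \<in> L_class a"
        using True m by (simp add: L_class_iff)
      ultimately show ?thesis
        by (metis image_eqI)
    next
      case False
      then obtain s where s: "a * x * s = a"
        using \<open>a \<in> right_ideal (a * x)\<close> by (metis right_ideal_iff)
      have "left_ideal (a * x * s) = left_ideal (m * s)"
        using m left_ideal_mult_right unfolding left_ideal_eq_iff by blast
      then have "m * s \<in> L_class a"
        by (simp add: s L_class_iff)
      \<comment> \<open>\<open>m\<close> is \<open>a * x\<close> or a left multiple of it, and axsx
        = ax.\<close>
      moreover have "m * s * x = m"
        using m s by (metis left_ideal_eq_iff left_ideal_iff mult.assoc)
      ultimately show ?thesis
        by (metis image_eqI)
    qed
  next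
    fix m assume "m \<in> (\<lambda>k. k * x) ` L_class a"
    then show "m \<in> L_class (a * x)"
      using left_ideal_mult_right by (auto simp: L_class_iff left_ideal_eq_iff)
  qed
qed


lemma R_translate:
  fixes a x :: "'a::{semigroup_mult, finite}"
  assumes "two_sided_ideal (x * a) = two_sided_ideal a"
  shows "(\<lambda>k. x * k) ` R_class a = R_class (x * a)"
proof -
  have "a \<in> left_ideal (x * a)"
    using assms stable_L[OF mult_in_ideals(1)[of x a]]
    by (simp add: two_sided_ideal_eq_iff left_ideal_eq_iff)
  show ?thesis
  proof (intro equalityI subsetI)
    fix m assume "m \<in> R_class (x * a)"
    then have m: "right_ideal (x * a) = right_ideal m"
      by (simp add: R_class_iff)
    show "m \<in> (\<lambda>k. x * k) ` R_class a"
    proof (cases "a = x * a")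
      case True
      then have "x * m = m"
        using m by (metis right_ideal_eq_iff right_ideal_iff mult.assoc)
      moreover have "m \<in> R_class a"
        using True m by (simp add: R_class_iff)
      ultimately show ?thesis
        by (metis image_eqI)
    next
      case False
      then obtain s where s: "s * (x * a) = a"
        using \<open>a \<in> left_ideal (x * a)\<close> by (metis left_ideal_iff)
      have "right_ideal (s * (x * a)) = right_ideal (s * m)"
        using m right_ideal_mult_left unfolding right_ideal_eq_iff by blast
      then have "s * m \<in> R_class a"
        by (simp add: s R_class_iff)
      moreover have "x * (s * m) = m"
        using m s by (metis right_ideal_eq_iff right_ideal_iff mult.assoc)
      ultimately show ?thesis
        by (metis image_eqI)
    qed
  next
    fix m assume "m \<in> (\<lambda>k. x * k) ` R_class a"
    then show "m \<in> R_class (x * a)"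
      using right_ideal_mult_left by (auto simp: R_class_iff right_ideal_eq_iff)
  qed
qed

section \<open>Idempotents and group H-classes\<close>

lemma idempotent_left_ideal: "e * e = e \<Longrightarrow> left_ideal a = left_ideal e \<Longrightarrow> a * e = a"
  unfolding left_ideal_eq_iff left_ideal_iff by (metis mult.assoc)

lemma idempotent_right_ideal: "e * e = e \<Longrightarrow> right_ideal a = right_ideal e \<Longrightarrow> e * a = a"
  unfolding right_ideal_eq_iff right_ideal_iff by (metis mult.assoc)

text \<open>One half of the Clifford-Miller theorem: if a = abv and b = uab, then bv = ua is the
  idempotent.\<close>

lemma idempotent_of_product:
  fixes a b :: "'a::{semigroup_mult, finite}"
  assumes "right_ideal (a * b) = right_ideal a" "left_ideal (a * b) = left_ideal b"
  obtains e where "e * e = e" "left_ideal e = left_ideal a" "right_ideal e = right_ideal b"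
proof -
  have a: "a = a * b \<or> (\<exists>v. a = a * b * v)" and b: "b = a * b \<or> (\<exists>u. b = u * (a * b))"
    using assms by (auto simp: right_ideal_eq_iff left_ideal_eq_iff right_ideal_iff left_ideal_iff)
  \<comment> \<open>The witness is \<open>b * v\<close>, or \<open>b\<close> itself when a = ab.
    These four properties suffice: a left identity for \<open>b\<close> that lies in bS^1 is
    idempotent.\<close>
  obtain e where e: "e \<in> right_ideal b" "e \<in> left_ideal a" "a * e = a" "e * b = b"
  proof (cases "a = a * b")
    case True
    then show ?thesis
      using b that[of b] by (metis left_ideal_iff mult.assoc right_ideal_iff)
  next
    case False
    then obtain v where v: "a = a * b * v"
      using a by blast
    show ?thesis
      using b v that[of "b * v"] by (metis left_ideal_iff mult.assoc right_ideal_iff)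
  qed
  have "e * e = e"
    using e by (metis mult.assoc right_ideal_iff)
  moreover have "left_ideal e = left_ideal a"
    using e by (metis left_ideal_eq_iff left_ideal_iff)
  moreover have "right_ideal e = right_ideal b"
    using e by (metis right_ideal_eq_iff right_ideal_iff)
  ultimately show thesis
    using that by blast
qed

text \<open>The other half of Clifford-Miller. \<open>e\<close> is a right identity for
  \<open>a\<close> and a left identity for \<open>b\<close>; multiplying b R e on the left by
  \<open>a\<close> gives ab R ae = a, and dually.\<close>

lemma product_of_idempotent:
  assumes "e * e = e" "left_ideal e = left_ideal a" "right_ideal e = right_ideal b"
  shows "right_ideal (a * b) = right_ideal a" "left_ideal (a * b) = left_ideal b"
proof -
  have "a * e = a" "e * b = b"
    using assms idempotent_left_ideal idempotent_right_ideal by metis+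
  moreover have "right_ideal (a * b) = right_ideal (a * e)"
    using assms(3) right_ideal_mult_left unfolding right_ideal_eq_iff by blast
  moreover have "left_ideal (a * b) = left_ideal (e * b)"
    using assms(2) left_ideal_mult_right unfolding left_ideal_eq_iff by blast
  ultimately show "right_ideal (a * b) = right_ideal a" "left_ideal (a * b) = left_ideal b"
    by simp_all
qed

lemma group_H_class_idempotent:
  fixes e :: "'a::{semigroup_mult, finite}"
  assumes e: "e * e = e"
  shows "group_H_class (L_class e \<inter> R_class e)"
proof -
  let ?H = "L_class e \<inter> R_class e"
  have H: "x \<in> ?H \<longleftrightarrow> left_ideal x = left_ideal e \<and> right_ideal x = right_ideal e" for x
    by (auto simp: L_class_iff R_class_iff)
  have "?H = green_H `` {e}"
    by (auto simp: L_class_def R_class_def green_H_def)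
  then have "?H \<in> UNIV // green_H"
    by (simp add: quotientI)
  moreover have "Group.group \<lparr>carrier = ?H, monoid.mult = (*), one = e\<rparr>"
  proof (rule groupI; unfold partial_object.simps monoid.simps)
    show "x * y \<in> ?H" if "x \<in> ?H" "y \<in> ?H" for x y
      using that product_of_idempotent[OF e, of x y] unfolding H by metis
    show "e \<in> ?H"
      unfolding H by simp
    show "x * y * z = x * (y * z)" if "x \<in> ?H" "y \<in> ?H" "z \<in> ?H" for x y z
      by (rule mult.assoc)
    show ex: "e * x = x" if "x \<in> ?H" for x
      using that e idempotent_right_ideal unfolding H by blast
    show "\<exists>y\<in>?H. y * x = e" if "x \<in> ?H" for x
    proof -
      have "e \<in> left_ideal x"
        using that unfolding H left_ideal_eq_iff by blast
      then obtain u where u: "e = u * x"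
        using e by (metis left_ideal_iff)
      \<comment> \<open>\<open>u\<close> is a left inverse of \<open>x\<close> that may lie outside
        the H-class. Sandwiching it between copies of \<open>e\<close> keeps yx = e; this equation
        gives y R e, and stability then gives y L e.\<close>
      define y where "y = e * u * e"
      have yx: "y * x = e"
        using u e ex[OF that] by (simp add: y_def mult.assoc)
      have "y \<in> right_ideal e"
        unfolding y_def by (metis right_ideal_iff mult.assoc)
      then have R: "right_ideal y = right_ideal e"
        using yx by (metis right_ideal_eq_iff mult_in_ideals(2))
      then have "e \<in> two_sided_ideal y"
        using right_ideal_eq_imp_two_sided two_sided_ideal_eq_iff by blast
      then have "left_ideal y = left_ideal e"
        unfolding y_def by (rule stable_L[OF mult_in_ideals(1)])
      then show ?thesis
        using R yx H by blast
    qed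
  qed
  ultimately show ?thesis
    unfolding group_H_class_def by blast
qed

text \<open>The identity of the group is the required idempotent, and its membership in the carrier
  locates its classes. Conversely, an idempotent makes its own H-class a group.\<close>

lemma group_H_class_iff:
  fixes a b :: "'a::{semigroup_mult, finite}"
  shows "group_H_class (L_class a \<inter> R_class b) \<longleftrightarrow>
    (\<exists>e. e * e = e \<and> left_ideal e = left_ideal a \<and> right_ideal e = right_ideal b)"
proof
  assume "group_H_class (L_class a \<inter> R_class b)"
  then obtain e where "Group.group \<lparr>carrier = L_class a \<inter> R_class b, monoid.mult = (*), one = e\<rparr>"
    unfolding group_H_class_def by blast
  then interpret G: Group.group "\<lparr>carrier = L_class a \<inter> R_class b, monoid.mult = (*), one = e\<rparr>" .
  have "e * e = e" "e \<in> L_class a \<inter> R_class b"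
    using G.one_closed G.l_one[OF G.one_closed] by simp_all
  then show "\<exists>e. e * e = e \<and> left_ideal e = left_ideal a \<and> right_ideal e = right_ideal b"
    by (auto simp: L_class_iff R_class_iff)
next
  assume "\<exists>e. e * e = e \<and> left_ideal e = left_ideal a \<and> right_ideal e = right_ideal b"
  then show "group_H_class (L_class a \<inter> R_class b)"
    using group_H_class_idempotent by (metis L_class_eq_iff R_class_eq_iff)
qed

section \<open>Closed sets and strongly connected components\<close>

lemma pverts_scc_quotient: "pverts (scc_quotient G) = pre_digraph.sccs_verts (with_proj G)"
  by (simp add: scc_quotient_def Let_def)

lemma parcs_scc_quotient:
  "(U, V) \<in> parcs (scc_quotient G) \<longleftrightarrow>
    U \<in> pverts (scc_quotient G) \<and> V \<in> pverts (scc_quotient G) \<and> U \<noteq> V \<and>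
    (\<exists>a\<in>U. \<exists>b\<in>V. (a, b) \<in> parcs G)"
  by (simp add: scc_quotient_def Let_def)

lemma scc_quotient_subset:
  assumes "pair_wf_digraph G" "U \<in> pverts (scc_quotient G)"
  shows "U \<subseteq> pverts G"
proof -
  interpret pair_wf_digraph G by fact
  show ?thesis
    using assms(2) sccs_verts_subsets by (auto simp: pverts_scc_quotient)
qed

lemma scc_quotient_cover:
  assumes "pair_wf_digraph G" "a \<in> pverts G"
  obtains U where "U \<in> pverts (scc_quotient G)" "a \<in> U"
proof -
  interpret pair_wf_digraph G by fact
  show ?thesis
    using that[of "scc_of a"] assms(2) scc_of_in_sccs_verts in_scc_of_self
    by (simp add: pverts_scc_quotient)
qed

lemma scc_quotient_saturated:
  assumes "pair_wf_digraph G" "W \<subseteq> pverts (scc_quotient G)" "U \<in> pverts (scc_quotient G)"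
    and "a \<in> U" "a \<in> \<Union>W"
  shows "U \<subseteq> \<Union>W"
proof -
  interpret pair_wf_digraph G by fact
  show ?thesis
    using assms(2-) sccs_verts_disjoint unfolding pverts_scc_quotient by blast
qed

text \<open>Merges (i) with (ii), or (i) with (iii), into closure under single arcs. An arc inside a
  component is handled by saturation, any other arc by an edge of the quotient. Conversely, an
  arc-closed set absorbs everything reachable from it.\<close>

lemma scc_quotient_closed_iff:
  assumes G: "pair_wf_digraph G" and A: "A \<subseteq> pverts G"
  shows "(\<exists>W \<subseteq> pverts (scc_quotient G). A = \<Union>W) \<and>
      (\<forall>U V. U \<subseteq> A \<and> (U, V) \<in> parcs (scc_quotient G) \<longrightarrow> V \<subseteq> A) \<longleftrightarrow>
    (\<forall>a b. (a, b) \<in> parcs G \<longrightarrow> a \<in> A \<longrightarrow> b \<in> A)"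
    (is "(\<exists>W\<subseteq>?Q. A = \<Union>W) \<and> ?arcs \<longleftrightarrow> ?closed")
proof
  interpret pair_wf_digraph G by fact
  assume *: "(\<exists>W\<subseteq>?Q. A = \<Union>W) \<and> ?arcs"
  then obtain W where W: "W \<subseteq> ?Q" "A = \<Union>W" and arcs: ?arcs
    by blast
  show ?closed
  proof (intro allI impI)
    fix a b assume ab: "(a, b) \<in> parcs G" and "a \<in> A"
    then obtain U where U: "U \<in> W" "a \<in> U"
      using W by blast
    obtain V where V: "V \<in> ?Q" "b \<in> V"
      using scc_quotient_cover[OF G] ab in_arcsD2 by metis
    show "b \<in> A"
    proof (cases "U = V")
      case False
      then have "(U, V) \<in> parcs (scc_quotient G)"
        using U V W ab by (auto simp: parcs_scc_quotient)
      then show ?thesis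
        using arcs U V W by blast
    qed (use U V W in blast)
  qed
next
  interpret pair_wf_digraph G by fact
  assume closed: ?closed
  have reach: "b \<in> A" if "a \<rightarrow>\<^sup>*\<^bsub>with_proj G\<^esub> b" "a \<in> A" for a b
    using that by (induction rule: reachable_induct) (use closed in auto)
  \<comment> \<open>Vertices of one component are mutually reachable, so a component that meets
    \<open>A\<close> lies in \<open>A\<close>.\<close>
  have sat: "U \<subseteq> A" if "U \<in> ?Q" "a \<in> U" "a \<in> A" for U a
    using that reach by (auto simp: pverts_scc_quotient in_sccs_verts_conv_reachable)
  show "(\<exists>W\<subseteq>?Q. A = \<Union>W) \<and> ?arcs"
  proof (intro conjI exI)
    show "{U \<in> ?Q. U \<subseteq> A} \<subseteq> ?Q"
      by blast
    show "A = \<Union>{U \<in> ?Q. U \<subseteq> A}"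
      using A scc_quotient_cover[OF G] sat by (auto, metis subsetD)
    show ?arcs
      using closed sat unfolding parcs_scc_quotient by blast
  qed
qed

section \<open>Elementwise form of the conditions\<close>

locale J_class_union_complement =
  fixes X T J :: "'a::{semigroup_mult, finite} set"
    and A B :: "'a set set"
  assumes generates: "generated_subsemigroup X = UNIV"
    and J_class: "J \<in> UNIV // green_J"
    and T_outside: "UNIV - T \<subseteq> J"
    and A_proper: "A \<subset> L_classes_in J"
    and B_proper: "B \<subset> R_classes_in J"
    and T_inside: "T \<inter> J = \<Union>A \<union> \<Union>B"
begin

section \<open>Classes and products inside J\<close>

lemma J_mem_iff: "a \<in> J \<Longrightarrow> b \<in> J \<longleftrightarrow> two_sided_ideal b = two_sided_ideal a"
  using J_class by (auto simp: quotient_def green_J_def)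

lemma L_classes_in_iff: "K \<in> L_classes_in J \<longleftrightarrow> (\<exists>a\<in>J. K = L_class a)"
proof -
  have "L_class a \<subseteq> J" if "a \<in> J" for a
    using that J_mem_iff left_ideal_eq_imp_two_sided unfolding subset_iff L_class_iff by metis
  moreover have "a \<in> L_class a" for a
    by (simp add: L_class_iff)
  ultimately show ?thesis
    unfolding L_classes_in_def quotient_def L_class_def by blast
qed

lemma R_classes_in_iff: "K \<in> R_classes_in J \<longleftrightarrow> (\<exists>a\<in>J. K = R_class a)"
proof -
  have "R_class a \<subseteq> J" if "a \<in> J" for a
    using that J_mem_iff right_ideal_eq_imp_two_sided unfolding subset_iff R_class_iff by metis
  moreover have "a \<in> R_class a" for a
    by (simp add: R_class_iff)
  ultimately show ?thesis
    unfolding R_classes_in_def quotient_def R_class_def by blast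
qed

lemma L_classes_in_mem:
  assumes "K \<in> L_classes_in J" "b \<in> K"
  shows "K = L_class b" "b \<in> J"
proof -
  obtain a where a: "a \<in> J" "K = L_class a"
    using assms(1) L_classes_in_iff by blast
  then have "left_ideal a = left_ideal b"
    using assms(2) by (simp add: L_class_iff)
  then show "K = L_class b" "b \<in> J"
    using a L_class_eq_iff J_mem_iff left_ideal_eq_imp_two_sided by blast+
qed

lemma A_E:
  assumes "K \<in> A"
  obtains a where "a \<in> J" "K = L_class a"
  using assms A_proper L_classes_in_iff by blast

lemma R_classes_in_mem:
  assumes "K \<in> R_classes_in J" "b \<in> K"
  shows "K = R_class b" "b \<in> J"
proof -
  obtain a where a: "a \<in> J" "K = R_class a"
    using assms(1) R_classes_in_iff by blast
  then have "right_ideal a = right_ideal b"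
    using assms(2) by (simp add: R_class_iff)
  then show "K = R_class b" "b \<in> J"
    using a R_class_eq_iff J_mem_iff right_ideal_eq_imp_two_sided by blast+
qed

lemma B_E:
  assumes "K \<in> B"
  obtains a where "a \<in> J" "K = R_class a"
  using assms B_proper R_classes_in_iff by blast

text \<open>Members of \<open>A\<close> are L-classes and members of \<open>B\<close> are R-classes,
  so the only ones that can contain \<open>a\<close> are its own two classes.\<close>

lemma T_mem_iff:
  assumes "a \<in> J"
  shows "a \<in> T \<longleftrightarrow> L_class a \<in> A \<or> R_class a \<in> B"
proof -
  have "a \<in> T \<longleftrightarrow> a \<in> \<Union>A \<union> \<Union>B"
    using T_inside assms by blast
  moreover have "K = L_class a" if "K \<in> A" "a \<in> K" for K
    using that by (metis A_E L_class_iff L_class_eq_iff)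
  moreover have "K = R_class a" if "K \<in> B" "a \<in> K" for K
    using that by (metis B_E R_class_iff R_class_eq_iff)
  moreover have "a \<in> L_class a" "a \<in> R_class a"
    by (simp_all add: L_class_iff R_class_iff)
  ultimately show ?thesis
    by blast
qed

text \<open>J-classes are convex in the J-order. This keeps partial products in J when the full
  product and one factor are there.\<close>

lemma ideal_between:
  assumes "a \<in> J" "c \<in> J" "c \<in> two_sided_ideal b" "b \<in> two_sided_ideal a"
  shows "b \<in> J"
proof -
  have "two_sided_ideal c = two_sided_ideal a"
    using assms(1,2) J_mem_iff by blast
  then have "two_sided_ideal b = two_sided_ideal a"
    using assms(3,4) by (metis two_sided_ideal_subset_iff subset_antisym)
  then show ?thesis
    using assms(1) J_mem_iff by blast
qed

lemma right_ideal_mult_J: "a \<in> J \<Longrightarrow> a * b \<in> J \<Longrightarrow> right_ideal (a * b) = right_ideal a"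
  using stable_R[OF mult_in_ideals(2)] J_mem_iff[of a "a * b"] unfolding two_sided_ideal_eq_iff by blast

lemma left_ideal_mult_J: "b \<in> J \<Longrightarrow> a * b \<in> J \<Longrightarrow> left_ideal (a * b) = left_ideal b"
  using stable_L[OF mult_in_ideals(1)] J_mem_iff[of b "a * b"] unfolding two_sided_ideal_eq_iff by blast

lemma L_meets_R_in_J:
  assumes "a \<in> J" "b \<in> J"
  obtains c where "c \<in> J" "L_class c = L_class a" "R_class c = R_class b"
proof -
  obtain c where c: "left_ideal c = left_ideal a" "right_ideal c = right_ideal b"
    using L_meets_R J_mem_iff assms by metis
  then have "c \<in> J"
    using assms J_mem_iff left_ideal_eq_imp_two_sided by blast
  with c that show thesis
    by (metis L_class_eq_iff R_class_eq_iff)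
qed

text \<open>The use of the properness of \<open>A\<close>: an L-class outside \<open>A\<close> makes
  membership in T depend on \<open>B\<close> alone.\<close>

lemma outside_A: obtains a where "a \<in> J" "L_class a \<notin> A"
proof -
  obtain K where "K \<in> L_classes_in J" "K \<notin> A"
    using A_proper by blast
  then show thesis
    using that by (auto simp: L_classes_in_iff)
qed

lemma outside_B: obtains b where "b \<in> J" "R_class b \<notin> B"
proof -
  obtain K where "K \<in> R_classes_in J" "K \<notin> B"
    using B_proper by blast
  then show thesis
    using that by (auto simp: R_classes_in_iff)
qed

text \<open>Replaces the order on classes by ideal membership. As J is itself a J-class, it differs
  from the class of \<open>x\<close> exactly when \<open>x\<close> is not in J.\<close>

lemma gens_above_iff:
  "x \<in> gens_above X J \<longleftrightarrow> x \<in> X \<and> x \<notin> J \<and> (\<forall>a\<in>J. a \<in> two_sided_ideal x)"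
proof -
  have *: "y \<in> green_J `` {x} \<longleftrightarrow> two_sided_ideal y = two_sided_ideal x" for y
    by (auto simp: green_J_def)
  have "J_class_le J (green_J `` {x}) \<longleftrightarrow> (\<forall>a\<in>J. a \<in> two_sided_ideal x)"
  proof -
    have "J_class_le J (green_J `` {x}) \<longleftrightarrow>
        (\<forall>a\<in>J. \<forall>y. two_sided_ideal y = two_sided_ideal x \<longrightarrow> two_sided_ideal a \<subseteq> two_sided_ideal y)"
      unfolding J_class_le_def Ball_def * by blast
    also have "\<dots> \<longleftrightarrow> (\<forall>a\<in>J. two_sided_ideal a \<subseteq> two_sided_ideal x)"
      by metis
    finally show ?thesis
      by (simp only: two_sided_ideal_subset_iff)
  qed
  moreover have "J = green_J `` {x} \<longleftrightarrow> x \<in> J"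
  proof
    show "x \<in> J" if "J = green_J `` {x}"
      using that * by blast
    show "J = green_J `` {x}" if "x \<in> J"
      using * J_mem_iff[OF that] by blast
  qed
  ultimately show ?thesis
    by (auto simp: gens_above_def J_class_less_def)
qed

section \<open>The subsemigroup generated by X'\<close>

abbreviation upper :: "'a set" where
  "upper \<equiv> generated_subsemigroup (gens_above X J)"

lemma subsemigroup_upper: "subsemigroup upper"
  unfolding generated_subsemigroup_def
  by (rule hull_in) (auto simp: subsemigroup_def)

lemma gens_above_subset_upper: "gens_above X J \<subseteq> upper"
  unfolding generated_subsemigroup_def by (rule hull_subset)

lemma upper_minimal: "subsemigroup P \<Longrightarrow> gens_above X J \<subseteq> P \<Longrightarrow> upper \<subseteq> P"
  unfolding generated_subsemigroup_def by (rule hull_minimal)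

text \<open>If \<open>J \<le> J\<^sub>b\<close> and \<open>b \<notin> J\<close>, every factor of \<open>b\<close> lies strictly above \<open>J\<close>.\<close>

lemma in_upper:
  assumes b: "b \<notin> J" and a: "a \<in> J" "a \<in> two_sided_ideal b"
  shows "b \<in> upper"
proof -
  \<comment> \<open>The implication itself is what passes to products; it holds on \<open>X\<close>,
    so \<open>P\<close> is the whole semigroup.\<close>
  define P where "P = {b. b \<notin> J \<and> a \<in> two_sided_ideal b \<longrightarrow> b \<in> upper}"
  have "subsemigroup P"
    unfolding subsemigroup_def
  proof (intro ballI)
    fix x y assume xy: "x \<in> P" "y \<in> P"
    show "x * y \<in> P"
      unfolding P_def
    proof (rule CollectI, rule impI)
      assume *: "x * y \<notin> J \<and> a \<in> two_sided_ideal (x * y)"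
      \<comment> \<open>A factor in J would force the product into J, since the product lies between
        that factor and \<open>a\<close> in the J-order.\<close>
      have "x \<notin> J" "y \<notin> J"
        using * ideal_between a(1) mult_in_ideals(3,4) by blast+
      moreover have "a \<in> two_sided_ideal x" "a \<in> two_sided_ideal y"
        using * mult_in_ideals(3,4) two_sided_ideal_subset_iff by blast+
      ultimately show "x * y \<in> upper"
        using xy subsemigroup_upper unfolding P_def subsemigroup_def by blast
    qed
  qed
  moreover have "X \<subseteq> P"
  proof
    fix x assume "x \<in> X"
    moreover have "c \<in> two_sided_ideal x" if "c \<in> J" "a \<in> two_sided_ideal x" for c
      using that a(1) J_mem_iff two_sided_ideal_subset_iff two_sided_ideal_eq_iff by blast
    ultimately show "x \<in> P"
      using gens_above_subset_upper gens_above_iff unfolding P_def by blast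
  qed
  ultimately have "P = UNIV"
    using generates hull_minimal[of X P subsemigroup] unfolding generated_subsemigroup_def by blast
  then show ?thesis
    using assms unfolding P_def by blast
qed

section \<open>Closure under X' and the elementwise criterion for T\<close>

definition "A_closed \<longleftrightarrow>
  (\<forall>a\<in>J. \<forall>x\<in>gens_above X J. a * x \<in> J \<longrightarrow> L_class a \<in> A \<longrightarrow> L_class (a * x) \<in> A)"

definition "B_closed \<longleftrightarrow>
  (\<forall>a\<in>J. \<forall>x\<in>gens_above X J. x * a \<in> J \<longrightarrow> R_class a \<in> B \<longrightarrow> R_class (x * a) \<in> B)"

text \<open>Closure passes from generators to products because, by convexity of J, no intermediate
  product leaves J.\<close>

lemma A_closed_upper:
  assumes A_closed and b: "b \<in> upper" and "a \<in> J" "a * b \<in> J" "L_class a \<in> A"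
  shows "L_class (a * b) \<in> A"
proof -
  let ?P = "{b. \<forall>a\<in>J. a * b \<in> J \<longrightarrow> L_class a \<in> A \<longrightarrow> L_class (a * b) \<in> A}"
  have "subsemigroup ?P"
    unfolding subsemigroup_def
  proof (intro ballI, rule CollectI, intro ballI impI)
    fix x y a
    assume xy: "x \<in> ?P" "y \<in> ?P" and a: "a \<in> J" "a * (x * y) \<in> J" "L_class a \<in> A"
    have "a * x \<in> J"
      using a(1,2) ideal_between mult_in_ideals(3) by (metis mult.assoc)
    then show "L_class (a * (x * y)) \<in> A"
      using xy a by (simp flip: mult.assoc)
  qed
  then have "upper \<subseteq> ?P"
    using assms(1) by (intro upper_minimal) (auto simp: A_closed_def)
  then show ?thesis
    using assms by blast
qed

lemma B_closed_upper:
  assumes B_closed and b: "b \<in> upper" and "a \<in> J" "b * a \<in> J" "R_class a \<in> B"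
  shows "R_class (b * a) \<in> B"
proof -
  let ?P = "{b. \<forall>a\<in>J. b * a \<in> J \<longrightarrow> R_class a \<in> B \<longrightarrow> R_class (b * a) \<in> B}"
  have "subsemigroup ?P"
    unfolding subsemigroup_def
  proof (intro ballI, rule CollectI, intro ballI impI)
    fix x y a
    assume xy: "x \<in> ?P" "y \<in> ?P" and a: "a \<in> J" "x * y * a \<in> J" "R_class a \<in> B"
    have "y * a \<in> J"
      using a(1,2) ideal_between mult_in_ideals(4) by (metis mult.assoc)
    then show "R_class (x * y * a) \<in> B"
      using xy a by (simp add: mult.assoc)
  qed
  then have "upper \<subseteq> ?P"
    using assms(1) by (intro upper_minimal) (auto simp: B_closed_def)
  then show ?thesis
    using assms by blast
qed

text \<open>For the closure claims and the idempotent claim, closure of T is tested on a product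
  with an L-class outside \<open>A\<close> or an R-class outside \<open>B\<close>, so that
  membership in T can come from one side at most.\<close>

lemma subsemigroup_imp:
  assumes T: "subsemigroup T"
  shows A_closed B_closed "upper \<subseteq> T"
    and "e * e = e \<Longrightarrow> e \<in> J \<Longrightarrow> L_class e \<in> A \<Longrightarrow> R_class e \<notin> B"
proof -
  have mult_T: "x * y \<in> T" if "x \<in> T" "y \<in> T" for x y
    using that T by (auto simp: subsemigroup_def)
  have gens_T: "gens_above X J \<subseteq> T"
    using gens_above_iff T_outside by blast
  show "upper \<subseteq> T"
    using T gens_T by (rule upper_minimal)
  obtain p where p: "p \<in> J" "L_class p \<notin> A"
    by (rule outside_A)
  obtain q where q: "q \<in> J" "R_class q \<notin> B"
    by (rule outside_B)
  show A_closed
    unfolding A_closed_def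
  proof (intro ballI impI)
    fix a x assume ax: "a \<in> J" "x \<in> gens_above X J" "a * x \<in> J" "L_class a \<in> A"
    \<comment> \<open>Moving \<open>a\<close> within its L-class to the R-class of \<open>q\<close>
      keeps it in T. Then cx stays in that R-class, so it can be in T only through
      \<open>A\<close>.\<close>
    obtain c where c: "c \<in> J" "L_class c = L_class a" "R_class c = R_class q"
      using L_meets_R_in_J ax(1) q(1) by blast
    have L: "left_ideal (c * x) = left_ideal (a * x)"
      using c(2) left_ideal_mult_right unfolding L_class_eq_iff left_ideal_eq_iff by blast
    then have "c * x \<in> J"
      using ax(3) J_mem_iff left_ideal_eq_imp_two_sided by blast
    moreover have "c * x \<in> T"
      using mult_T gens_T ax c T_mem_iff by auto
    moreover have "R_class (c * x) = R_class q"
      using right_ideal_mult_J c(1,3) \<open>c * x \<in> J\<close> by (metis R_class_eq_iff)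
    ultimately show "L_class (a * x) \<in> A"
      using L q(2) T_mem_iff by (metis L_class_eq_iff)
  qed
  show B_closed
    unfolding B_closed_def
  proof (intro ballI impI)
    fix a x assume ax: "a \<in> J" "x \<in> gens_above X J" "x * a \<in> J" "R_class a \<in> B"
    obtain c where c: "c \<in> J" "L_class c = L_class p" "R_class c = R_class a"
      using L_meets_R_in_J ax(1) p(1) by blast
    have R: "right_ideal (x * c) = right_ideal (x * a)"
      using c(3) right_ideal_mult_left unfolding R_class_eq_iff right_ideal_eq_iff by blast
    then have "x * c \<in> J"
      using ax(3) J_mem_iff right_ideal_eq_imp_two_sided by blast
    moreover have "x * c \<in> T"
      using mult_T gens_T ax c T_mem_iff by auto
    moreover have "L_class (x * c) = L_class p"
      using left_ideal_mult_J c(1,2) \<open>x * c \<in> J\<close> by (metis L_class_eq_iff)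
    ultimately show "R_class (x * a) \<in> B"
      using R p(2) T_mem_iff by (metis R_class_eq_iff)
  qed
  show "R_class e \<notin> B" if e: "e * e = e" "e \<in> J" "L_class e \<in> A"
  proof
    assume "R_class e \<in> B"
    \<comment> \<open>\<open>a\<close> lies in T through \<open>A\<close> and \<open>b\<close>
      through \<open>B\<close>, while Clifford-Miller puts ab in the L-class of \<open>p\<close> and
      the R-class of \<open>q\<close>, hence outside T.\<close>
    obtain a where a: "a \<in> J" "L_class a = L_class e" "R_class a = R_class q"
      using L_meets_R_in_J e(2) q(1) by blast
    obtain b where b: "b \<in> J" "L_class b = L_class p" "R_class b = R_class e"
      using L_meets_R_in_J e(2) p(1) by blast
    have ab: "right_ideal (a * b) = right_ideal a" "left_ideal (a * b) = left_ideal b"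
      using product_of_idempotent[OF e(1)] a(2) b(3) by (metis L_class_eq_iff R_class_eq_iff)+
    then have "a * b \<in> J"
      using a(1) J_mem_iff right_ideal_eq_imp_two_sided by blast
    moreover have "a * b \<in> T"
      using mult_T T_mem_iff a b e(3) \<open>R_class e \<in> B\<close> by simp
    moreover have "L_class (a * b) = L_class p" "R_class (a * b) = R_class q"
      using ab a(3) b(2) by (metis L_class_eq_iff, metis R_class_eq_iff)
    ultimately show False
      using p(2) q(2) T_mem_iff by metis
  qed
qed

lemma subsemigroup_if:
  assumes A_closed B_closed and upper_T: "upper \<inter> J \<subseteq> T"
    and idem: "\<And>e. e * e = e \<Longrightarrow> e \<in> J \<Longrightarrow> L_class e \<in> A \<Longrightarrow> R_class e \<notin> B"
  shows "subsemigroup T"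
  unfolding subsemigroup_def
proof (intro ballI)
  fix a b assume ab: "a \<in> T" "b \<in> T"
  show "a * b \<in> T"
  proof (cases "a * b \<in> J")
    case False
    then show ?thesis
      using T_outside by blast
  next
    case J: True
    have a_upper: "a \<in> upper" if "a \<notin> J"
      using in_upper that J mult_in_ideals(3) by blast
    have b_upper: "b \<in> upper" if "b \<notin> J"
      using in_upper that J mult_in_ideals(4) by blast
    have R: "R_class (a * b) = R_class a" if "a \<in> J"
      using right_ideal_mult_J that J by (simp add: R_class_eq_iff)
    have L: "L_class (a * b) = L_class b" if "b \<in> J"
      using left_ideal_mult_J that J by (simp add: L_class_eq_iff)
    consider "a \<in> J" "b \<in> J" | "a \<in> J" "b \<notin> J" | "a \<notin> J" "b \<in> J" | "a \<notin> J" "b \<notin> J"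
      by blast
    then show ?thesis
    proof cases
      case 1
      then obtain e where e: "e * e = e" "left_ideal e = left_ideal a" "right_ideal e = right_ideal b"
        using idempotent_of_product right_ideal_mult_J left_ideal_mult_J J by metis
      then have "e \<in> J"
        using 1 J_mem_iff left_ideal_eq_imp_two_sided by blast
      \<comment> \<open>The product has the R-class of \<open>a\<close> and the L-class of
        \<open>b\<close>. With both factors in T, it can miss T only if \<open>a\<close> is in T
        through \<open>A\<close> alone and \<open>b\<close> through \<open>B\<close> alone.\<close>
      then have "\<not> (L_class a \<in> A \<and> R_class b \<in> B)"
        using idem e by (metis L_class_eq_iff R_class_eq_iff)
      then show ?thesis
        using 1 ab R L J T_mem_iff by auto
    next
      \<comment> \<open>If the R-class of \<open>a\<close> is in \<open>B\<close>, the product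
        inherits it; if its L-class is in \<open>A\<close>, closure along \<open>upper\<close>
        applies.\<close>
      case 2
      then show ?thesis
        using A_closed_upper[OF assms(1) b_upper _ J] ab R J T_mem_iff by auto
    next
      case 3
      then show ?thesis
        using B_closed_upper[OF assms(2) a_upper _ J] ab L J T_mem_iff by auto
    next
      case 4
      then have "a * b \<in> upper"
        using a_upper b_upper subsemigroup_upper by (simp add: subsemigroup_def)
      then show ?thesis
        using J upper_T by blast
    qed
  qed
qed

section \<open>From elements to the digraphs on classes\<close>

lemma wf_L_digraph: "pair_wf_digraph (L_digraph X J)"
  by unfold_locales (auto simp: L_digraph_def)

lemma wf_R_digraph: "pair_wf_digraph (R_digraph X J)"
  by unfold_locales (auto simp: R_digraph_def)

text \<open>By \<open>L_translate\<close>, a single product ax in J already carries the whole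
  L-class onto an L-class, giving an arc. The digraph has no loops, but a product that stays in its
  L-class satisfies \<open>A_closed\<close> trivially.\<close>

lemma A_closed_iff: "A_closed \<longleftrightarrow> (\<forall>K M. (K, M) \<in> parcs (L_digraph X J) \<longrightarrow> K \<in> A \<longrightarrow> M \<in> A)"
proof
  assume A_closed
  show "\<forall>K M. (K, M) \<in> parcs (L_digraph X J) \<longrightarrow> K \<in> A \<longrightarrow> M \<in> A"
  proof (intro allI impI)
    fix K M assume "(K, M) \<in> parcs (L_digraph X J)" "K \<in> A"
    then obtain x where x: "x \<in> gens_above X J" "M \<in> L_classes_in J" "(\<lambda>k. k * x) ` K = M"
      by (auto simp: L_digraph_def)
    obtain a where a: "a \<in> J" "K = L_class a"
      using A_E \<open>K \<in> A\<close> by blast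
    have "a \<in> K"
      by (simp add: a L_class_iff)
    then have "a * x \<in> M"
      using x(3) by blast
    then have "M = L_class (a * x)" "a * x \<in> J"
      using x(2) L_classes_in_mem by blast+
    then show "M \<in> A"
      using \<open>A_closed\<close> x(1) a \<open>K \<in> A\<close> by (auto simp: A_closed_def)
  qed
next
  assume *: "\<forall>K M. (K, M) \<in> parcs (L_digraph X J) \<longrightarrow> K \<in> A \<longrightarrow> M \<in> A"
  show A_closed
    unfolding A_closed_def
  proof (intro ballI impI)
    fix a x assume ax: "a \<in> J" "x \<in> gens_above X J" "a * x \<in> J" "L_class a \<in> A"
    have "(\<lambda>k. k * x) ` L_class a = L_class (a * x)"
      using ax J_mem_iff by (intro L_translate) blast
    then have "L_class a \<noteq> L_class (a * x) \<Longrightarrow> (L_class a, L_class (a * x)) \<in> parcs (L_digraph X J)"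
      using ax L_classes_in_iff by (auto simp: L_digraph_def)
    then show "L_class (a * x) \<in> A"
      using * ax(4) by metis
  qed
qed

lemma B_closed_iff: "B_closed \<longleftrightarrow> (\<forall>K M. (K, M) \<in> parcs (R_digraph X J) \<longrightarrow> K \<in> B \<longrightarrow> M \<in> B)"
proof
  assume B_closed
  show "\<forall>K M. (K, M) \<in> parcs (R_digraph X J) \<longrightarrow> K \<in> B \<longrightarrow> M \<in> B"
  proof (intro allI impI)
    fix K M assume "(K, M) \<in> parcs (R_digraph X J)" "K \<in> B"
    then obtain x where x: "x \<in> gens_above X J" "M \<in> R_classes_in J" "(\<lambda>k. x * k) ` K = M"
      by (auto simp: R_digraph_def)
    obtain a where a: "a \<in> J" "K = R_class a"
      using B_E \<open>K \<in> B\<close> by blast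
    have "a \<in> K"
      by (simp add: a R_class_iff)
    then have "x * a \<in> M"
      using x(3) by blast
    then have "M = R_class (x * a)" "x * a \<in> J"
      using x(2) R_classes_in_mem by blast+
    then show "M \<in> B"
      using \<open>B_closed\<close> x(1) a \<open>K \<in> B\<close> by (auto simp: B_closed_def)
  qed
next
  assume *: "\<forall>K M. (K, M) \<in> parcs (R_digraph X J) \<longrightarrow> K \<in> B \<longrightarrow> M \<in> B"
  show B_closed
    unfolding B_closed_def
  proof (intro ballI impI)
    fix a x assume ax: "a \<in> J" "x \<in> gens_above X J" "x * a \<in> J" "R_class a \<in> B"
    have "(\<lambda>k. x * k) ` R_class a = R_class (x * a)"
      using ax J_mem_iff by (intro R_translate) blast
    then have "R_class a \<noteq> R_class (x * a) \<Longrightarrow> (R_class a, R_class (x * a)) \<in> parcs (R_digraph X J)"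
      using ax R_classes_in_iff by (auto simp: R_digraph_def)
    then show "R_class (x * a) \<in> B"
      using * ax(4) by metis
  qed
qed

lemma Gamma_L_closed_iff:
  "(\<exists>W \<subseteq> pverts (Gamma_L X J). A = \<Union>W) \<and>
      (\<forall>U V. U \<subseteq> A \<and> (U, V) \<in> parcs (Gamma_L X J) \<longrightarrow> V \<subseteq> A) \<longleftrightarrow> A_closed"
  unfolding Gamma_L_def A_closed_iff using A_proper
  by (intro scc_quotient_closed_iff[OF wf_L_digraph]) (auto simp: L_digraph_def)

lemma Gamma_R_closed_iff:
  "(\<exists>W \<subseteq> pverts (Gamma_R X J). B = \<Union>W) \<and>
      (\<forall>U V. U \<subseteq> B \<and> (U, V) \<in> parcs (Gamma_R X J) \<longrightarrow> V \<subseteq> B) \<longleftrightarrow> B_closed"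
  unfolding Gamma_R_def B_closed_iff using B_proper
  by (intro scc_quotient_closed_iff[OF wf_R_digraph]) (auto simp: R_digraph_def)

lemma Gamma_L_vertex:
  assumes "a \<in> J"
  obtains U where "U \<in> pverts (Gamma_L X J)" "L_class a \<in> U"
proof -
  have "L_class a \<in> pverts (L_digraph X J)"
    using assms L_classes_in_iff by (auto simp: L_digraph_def)
  then show thesis
    using that scc_quotient_cover[OF wf_L_digraph] unfolding Gamma_L_def by blast
qed

lemma Gamma_R_vertex:
  assumes "a \<in> J"
  obtains V where "V \<in> pverts (Gamma_R X J)" "R_class a \<in> V"
proof -
  have "R_class a \<in> pverts (R_digraph X J)"
    using assms R_classes_in_iff by (auto simp: R_digraph_def)
  then show thesis
    using that scc_quotient_cover[OF wf_R_digraph] unfolding Gamma_R_def by blast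
qed

lemma Gamma_L_vertexE:
  assumes "U \<in> pverts (Gamma_L X J)" "K \<in> U"
  obtains a where "a \<in> J" "K = L_class a"
proof -
  have "U \<subseteq> pverts (L_digraph X J)"
    using assms(1) scc_quotient_subset[OF wf_L_digraph] unfolding Gamma_L_def by blast
  then have "K \<in> L_classes_in J"
    using assms(2) by (auto simp: L_digraph_def)
  then show thesis
    using that L_classes_in_iff by blast
qed

lemma Gamma_R_vertexE:
  assumes "V \<in> pverts (Gamma_R X J)" "K \<in> V"
  obtains a where "a \<in> J" "K = R_class a"
proof -
  have "V \<subseteq> pverts (R_digraph X J)"
    using assms(1) scc_quotient_subset[OF wf_R_digraph] unfolding Gamma_R_def by blast
  then have "K \<in> R_classes_in J"
    using assms(2) by (auto simp: R_digraph_def)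
  then show thesis
    using that R_classes_in_iff by blast
qed

section \<open>The conditions on Theta and Delta, assuming (i)\<close>

context
  assumes A_union: "\<exists>W \<subseteq> pverts (Gamma_L X J). A = \<Union>W"
    and B_union: "\<exists>W \<subseteq> pverts (Gamma_R X J). B = \<Union>W"
begin

text \<open>As \<open>A\<close> is a union of components, containment of a vertex in
  \<open>A\<close> can be tested on any one of its classes. This reduces (iv) and (v) to statements
  about elements.\<close>

lemma A_vertex_iff: "U \<in> pverts (Gamma_L X J) \<Longrightarrow> K \<in> U \<Longrightarrow> U \<subseteq> A \<longleftrightarrow> K \<in> A"
  using A_union scc_quotient_saturated[OF wf_L_digraph] unfolding Gamma_L_def by blast

lemma B_vertex_iff: "V \<in> pverts (Gamma_R X J) \<Longrightarrow> K \<in> V \<Longrightarrow> V \<subseteq> B \<longleftrightarrow> K \<in> B"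
  using B_union scc_quotient_saturated[OF wf_R_digraph] unfolding Gamma_R_def by blast

text \<open>An element t of \<open>upper\<close> in J yields the edge joining the components of its
  two classes, and every edge arises from such a t. By saturation, one end lies in \<open>A\<close>
  or \<open>B\<close> exactly when t is in T.\<close>

lemma Theta_iff:
  "(\<forall>u v. {u, v} \<in> snd (Theta X J) \<longrightarrow> bivertex_in A B u \<or> bivertex_in A B v) \<longleftrightarrow>
    upper \<inter> J \<subseteq> T"
proof
  assume *: "\<forall>u v. {u, v} \<in> snd (Theta X J) \<longrightarrow> bivertex_in A B u \<or> bivertex_in A B v"
  show "upper \<inter> J \<subseteq> T"
  proof
    fix t assume t: "t \<in> upper \<inter> J"
    obtain U where U: "U \<in> pverts (Gamma_L X J)" "L_class t \<in> U"
      using t Gamma_L_vertex by blast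
    obtain V where V: "V \<in> pverts (Gamma_R X J)" "R_class t \<in> V"
      using t Gamma_R_vertex by blast
    have "t \<in> upper \<inter> (L_class t \<inter> R_class t)"
      using t by (simp add: L_class_iff R_class_iff)
    then have "{Inl U, Inr V} \<in> snd (Theta X J)"
      using U V unfolding Theta_def snd_conv by blast
    then have "U \<subseteq> A \<or> V \<subseteq> B"
      using * by (fastforce simp: bivertex_in_def)
    then show "t \<in> T"
      using U V t T_mem_iff by blast
  qed
next
  assume *: "upper \<inter> J \<subseteq> T"
  have "U \<subseteq> A \<or> V \<subseteq> B"
    if U: "U \<in> pverts (Gamma_L X J)" "K \<in> U" and V: "V \<in> pverts (Gamma_R X J)" "M \<in> V"
      and t: "t \<in> upper" "t \<in> K" "t \<in> M" for U V K M t
  proof -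
    have "K \<in> L_classes_in J" "M \<in> R_classes_in J"
      using U V Gamma_L_vertexE Gamma_R_vertexE L_classes_in_iff R_classes_in_iff by metis+
    then have "t \<in> J" "K = L_class t" "M = R_class t"
      using t(2,3) L_classes_in_mem R_classes_in_mem by blast+
    then show ?thesis
      using * t(1) T_mem_iff A_vertex_iff[OF U] B_vertex_iff[OF V] by blast
  qed
  \<comment> \<open>Edges are unordered, so either of \<open>u\<close> and \<open>v\<close> may be
    the end tagged \<open>Inl\<close>.\<close>
  then show "\<forall>u v. {u, v} \<in> snd (Theta X J) \<longrightarrow> bivertex_in A B u \<or> bivertex_in A B v"
    unfolding Theta_def by (fastforce simp: doubleton_eq_iff bivertex_in_def)
qed

text \<open>Edges of Delta join an \<open>Inl\<close> to an \<open>Inr\<close> vertex, so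
  independence concerns only pairs with one vertex in \<open>A\<close> and the other in
  \<open>B\<close>. The group H-classes creating these edges are those of idempotents of J.\<close>

lemma Delta_iff:
  "independent_in (Delta X J) {v \<in> bivertices X J. bivertex_in A B v} \<longleftrightarrow>
    (\<forall>e\<in>J. e * e = e \<longrightarrow> L_class e \<in> A \<longrightarrow> R_class e \<notin> B)"
    (is "?indep \<longleftrightarrow> ?idem")
proof
  assume ?indep
  show ?idem
  proof (intro ballI impI notI)
    fix e assume e: "e \<in> J" "e * e = e" "L_class e \<in> A" "R_class e \<in> B"
    obtain U where U: "U \<in> pverts (Gamma_L X J)" "L_class e \<in> U"
      using e Gamma_L_vertex by blast
    obtain V where V: "V \<in> pverts (Gamma_R X J)" "R_class e \<in> V"
      using e Gamma_R_vertex by blast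
    have "{Inl U, Inr V} \<in> snd (Delta X J)"
      using U V group_H_class_idempotent[OF e(2)] unfolding Delta_def snd_conv by blast
    moreover have "Inl U \<in> {v \<in> bivertices X J. bivertex_in A B v}"
      "Inr V \<in> {v \<in> bivertices X J. bivertex_in A B v}"
      using U V e A_vertex_iff B_vertex_iff by (auto simp: bivertices_def bivertex_in_def)
    ultimately show False
      using \<open>?indep\<close> unfolding independent_in_def by blast
  qed
next
  assume ?idem
  have "\<not> (U \<subseteq> A \<and> V \<subseteq> B)"
    if U: "U \<in> pverts (Gamma_L X J)" "K \<in> U" and V: "V \<in> pverts (Gamma_R X J)" "M \<in> V"
      and H: "group_H_class (K \<inter> M)" for U V K M
  proof -
    obtain a where a: "a \<in> J" "K = L_class a"
      using Gamma_L_vertexE U by blast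
    obtain b where b: "b \<in> J" "M = R_class b"
      using Gamma_R_vertexE V by blast
    obtain e where e: "e * e = e" "left_ideal e = left_ideal a" "right_ideal e = right_ideal b"
      using H a b group_H_class_iff by blast
    then have "e \<in> J"
      using a(1) J_mem_iff left_ideal_eq_imp_two_sided by blast
    then have "\<not> (K \<in> A \<and> M \<in> B)"
      using \<open>?idem\<close> e a b by (metis L_class_eq_iff R_class_eq_iff)
    then show ?thesis
      using U V by blast
  qed
  then show ?indep
    unfolding independent_in_def Delta_def
    by (fastforce simp: doubleton_eq_iff bivertex_in_def)
qed

end

end

theorem proposition3p10:
  fixes X T J :: "'a::{semigroup_mult, finite} set"
    and A B :: "'a set set"
  assumes "generated_subsemigroup X = UNIV"
    and "T \<subset> UNIV"
    and "regular_J_class J"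
    and "UNIV - T \<subseteq> J"
    and "A \<subset> L_classes_in J"
    and "B \<subset> R_classes_in J"
    and "T \<inter> J = \<Union>A \<union> \<Union>B"
  shows "subsemigroup T \<longleftrightarrow>
      ((\<exists>W \<subseteq> pverts (Gamma_L X J). A = \<Union>W) \<and> (\<exists>W \<subseteq> pverts (Gamma_R X J). B = \<Union>W)) \<and>
      (\<forall>U V. U \<subseteq> A \<and> (U, V) \<in> parcs (Gamma_L X J) \<longrightarrow> V \<subseteq> A) \<and>
      (\<forall>U V. U \<subseteq> B \<and> (U, V) \<in> parcs (Gamma_R X J) \<longrightarrow> V \<subseteq> B) \<and>
      (\<forall>u v. {u, v} \<in> snd (Theta X J) \<longrightarrow> bivertex_in A B u \<or> bivertex_in A B v) \<and>
      independent_in (Delta X J) {v \<in> bivertices X J. bivertex_in A B v}"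
    (is "_ \<longleftrightarrow> (?A \<and> ?B) \<and> ?LA \<and> ?RB \<and> ?Theta \<and> ?Delta")
proof -
  interpret J_class_union_complement X T J A B
    using assms by unfold_locales (auto simp: regular_J_class_def)
  have "subsemigroup T \<longleftrightarrow> A_closed \<and> B_closed \<and> upper \<inter> J \<subseteq> T \<and>
      (\<forall>e\<in>J. e * e = e \<longrightarrow> L_class e \<in> A \<longrightarrow> R_class e \<notin> B)"
    using subsemigroup_imp subsemigroup_if by blast
  \<comment> \<open>\<open>Theta_iff\<close> and \<open>Delta_iff\<close> presuppose (i). Both sides
    provide it: the right side states it, and \<open>A_closed\<close> and \<open>B_closed\<close>
    imply it.\<close>
  then show ?thesis
    using Gamma_L_closed_iff Gamma_R_closed_iff Theta_iff Delta_iff by argo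
qed

end
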